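(* Let $\mathcal H$ be a complex separable infinite dimensional Hilbert space. There is no nonzero Jordan homomorphism $\Phi:\ell_\infty(\mathbb N,\mathcal B(\mathcal H))\to\mathcal B(\mathcal H)$ which vanishes on every sequence $(A_n)_n\in\ell_\infty(\mathbb N,\mathcal B(\mathcal H))$ having only finitely many nonzero coordinates.
   Context: $\mathcal B(\mathcal H)$ denotes the $C^*$-algebra of all bounded linear operators on $\mathcal H$. $\ell_\infty(\mathbb N,\mathcal B(\mathcal H))=\{(A_n)_n : A_n\in\mathcal B(\mathcal H)\ (n\in\mathbb N),\ \sup_n\|A_n\|<\infty\}$ is a $C^*$-algebra with coordinatewise operations and the supremum norm. If $\mathcal R$ and $\mathcal R'$ are algebras, a linear map $\phi:\mathcal R\to\mathcal R'$ is called a Jordan homomorphism if $\phi(A)^2=\phi(A^2)$ for every $A\in\mathcal R$ (no continuity or preservation of the involution is assumed). *)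

theory Defs
  imports "HOL-Analysis.Analysis"
begin

section \<open>Complex vector spaces and Hilbert spaces\<close>

text \<open>The real scalar multiplication inherited from the library is required to be the
  restriction of the complex one.\<close>

class complex_vector = real_vector +
  fixes scaleC :: "complex \<Rightarrow> 'a \<Rightarrow> 'a" (infixr \<open>*\<^sub>C\<close> 75)
  assumes scaleC_add_right: "a *\<^sub>C (x + y) = a *\<^sub>C x + a *\<^sub>C y"
    and scaleC_add_left: "(a + b) *\<^sub>C x = a *\<^sub>C x + b *\<^sub>C x"
    and scaleC_scaleC: "a *\<^sub>C (b *\<^sub>C x) = (a * b) *\<^sub>C x"
    and scaleC_one: "1 *\<^sub>C x = x"
    and scaleR_scaleC: "r *\<^sub>R x = complex_of_real r *\<^sub>C x"

global_interpretation complex_vector: vector_space "scaleC :: complex \<Rightarrow> 'a \<Rightarrow> 'a::complex_vector"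
  defines complex_span = complex_vector.span
  by standard (simp_all add: scaleC_add_right scaleC_add_left scaleC_scaleC scaleC_one)

definition infinite_dimensional :: "'a::complex_vector itself \<Rightarrow> bool" where
  "infinite_dimensional _ \<longleftrightarrow> \<not> (\<exists>B :: 'a set. finite B \<and> complex_span B = UNIV)"

text \<open>Positive definiteness of the inner product follows from
  \<open>norm_eq_sqrt_cinner\<close>, and completeness is part of \<open>banach\<close>.\<close>

class complex_hilbert_space = complex_vector + banach +
  fixes cinner :: "'a \<Rightarrow> 'a \<Rightarrow> complex"
  assumes cinner_commute: "cinner x y = cnj (cinner y x)"
    and cinner_add_left: "cinner (x + y) z = cinner x z + cinner y z"
    and cinner_scaleC_left: "cinner (c *\<^sub>C x) y = c * cinner x y"
    and cinner_self_nonneg: "0 \<le> Re (cinner x x)"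
    and norm_eq_sqrt_cinner: "norm x = sqrt (Re (cinner x x))"

lemma norm_scaleC_hilbert: "norm (c *\<^sub>C x) = cmod c * norm x"
  for x :: "'a::complex_hilbert_space"
proof -
  have "cinner (c *\<^sub>C x) (c *\<^sub>C x) = c * cnj c * cinner x x"
    by (metis cinner_commute cinner_scaleC_left complex_cnj_mult mult.assoc)
  also have "c * cnj c = complex_of_real ((cmod c)\<^sup>2)"
    by (metis complex_norm_square)
  finally have "Re (cinner (c *\<^sub>C x) (c *\<^sub>C x)) = (cmod c)\<^sup>2 * Re (cinner x x)"
    by simp
  then show ?thesis
    by (simp add: norm_eq_sqrt_cinner real_sqrt_mult)
qed

section \<open>Complex algebras and Jordan homomorphisms\<close>

class complex_algebra = complex_vector + ring +
  assumes mult_scaleC_left: "(c *\<^sub>C x) * y = c *\<^sub>C (x * y)"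
    and mult_scaleC_right: "x * (c *\<^sub>C y) = c *\<^sub>C (x * y)"

class complex_normed_algebra = complex_algebra + real_normed_algebra +
  assumes norm_scaleC: "norm (c *\<^sub>C x) = cmod c * norm x"

definition jordan_homomorphism :: "('r::complex_algebra \<Rightarrow> 's::complex_algebra) \<Rightarrow> bool" where
  "jordan_homomorphism \<phi> \<longleftrightarrow>
     Vector_Spaces.linear scaleC scaleC \<phi> \<and> (\<forall>A. \<phi> A * \<phi> A = \<phi> (A * A))"

section \<open>The algebra of bounded operators on a Hilbert space\<close>

text \<open>The library type of bounded linear maps consists of real-linear maps, hence the explicit
  requirement of complex homogeneity.\<close>

typedef (overloaded) 'a bounded_op =
  "{A :: 'a::complex_hilbert_space \<Rightarrow>\<^sub>L 'a. \<forall>c x. blinfun_apply A (c *\<^sub>C x) = c *\<^sub>C blinfun_apply A x}"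
  morphisms blinfun_of_op Abs_bounded_op
  by (rule exI[of _ 0]) simp

setup_lifting type_definition_bounded_op

lemma bounded_linear_scaleC_hilbert: "bounded_linear (\<lambda>x. c *\<^sub>C (x::'a::complex_hilbert_space))"
  by (rule bounded_linear_intro[where K = "cmod c"])
    (simp_all add: scaleC_add_right scaleR_scaleC scaleC_scaleC norm_scaleC_hilbert mult.commute)

lift_definition blinfun_scaleC ::
  "complex \<Rightarrow> ('b::real_normed_vector \<Rightarrow>\<^sub>L 'a::complex_hilbert_space) \<Rightarrow> 'b \<Rightarrow>\<^sub>L 'a"
  is "\<lambda>c f x. c *\<^sub>C f x"
  by (rule bounded_linear_compose[OF bounded_linear_scaleC_hilbert])

lemma norm_blinfun_scaleC_le: "norm (blinfun_scaleC c f) \<le> cmod c * norm f"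
  by (rule norm_blinfun_bound)
    (simp_all add: blinfun_scaleC.rep_eq norm_scaleC_hilbert mult.assoc mult_left_mono norm_blinfun)

lemma norm_blinfun_scaleC: "norm (blinfun_scaleC c f) = cmod c * norm f"
proof (cases "c = 0")
  case True
  then show ?thesis
    using norm_blinfun_scaleC_le[of c f] by simp
next
  case False
  have "blinfun_scaleC (inverse c) (blinfun_scaleC c f) = f"
    using False by (intro blinfun_eqI) (simp add: blinfun_scaleC.rep_eq scaleC_scaleC scaleC_one)
  then have "norm f \<le> cmod (inverse c) * norm (blinfun_scaleC c f)"
    by (metis norm_blinfun_scaleC_le)
  then have "cmod c * norm f \<le> norm (blinfun_scaleC c f)"
    using False unfolding norm_inverse by (simp add: field_simps)
  then show ?thesis
    using norm_blinfun_scaleC_le[of c f] by simp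
qed

instantiation bounded_op :: (complex_hilbert_space) complex_normed_algebra
begin

lift_definition zero_bounded_op :: "'a bounded_op" is 0
  by simp

lift_definition plus_bounded_op :: "'a bounded_op \<Rightarrow> 'a bounded_op \<Rightarrow> 'a bounded_op" is "(+)"
  by (simp add: blinfun.add_left scaleC_add_right)

lift_definition uminus_bounded_op :: "'a bounded_op \<Rightarrow> 'a bounded_op" is uminus
  by (simp add: blinfun.minus_left)

lift_definition minus_bounded_op :: "'a bounded_op \<Rightarrow> 'a bounded_op \<Rightarrow> 'a bounded_op" is "(-)"
  by (simp add: blinfun.diff_left complex_vector.scale_right_diff_distrib)

lift_definition times_bounded_op :: "'a bounded_op \<Rightarrow> 'a bounded_op \<Rightarrow> 'a bounded_op" is "(o\<^sub>L)"
  by simp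

lift_definition scaleC_bounded_op :: "complex \<Rightarrow> 'a bounded_op \<Rightarrow> 'a bounded_op" is blinfun_scaleC
  by (simp add: blinfun_scaleC.rep_eq scaleC_scaleC mult.commute)

lift_definition scaleR_bounded_op :: "real \<Rightarrow> 'a bounded_op \<Rightarrow> 'a bounded_op" is "(*\<^sub>R)"
  by (simp add: blinfun.scaleR_left scaleR_scaleC scaleC_scaleC mult.commute)

lift_definition norm_bounded_op :: "'a bounded_op \<Rightarrow> real" is norm .

definition sgn_bounded_op :: "'a bounded_op \<Rightarrow> 'a bounded_op"
  where "sgn_bounded_op A = inverse (norm A) *\<^sub>R A"

definition dist_bounded_op :: "'a bounded_op \<Rightarrow> 'a bounded_op \<Rightarrow> real"
  where "dist_bounded_op A B = norm (A - B)"

definition uniformity_bounded_op :: "('a bounded_op \<times> 'a bounded_op) filter"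
  where "uniformity_bounded_op = (INF e\<in>{0 <..}. principal {(A, B). dist A B < e})"

definition open_bounded_op :: "'a bounded_op set \<Rightarrow> bool"
  where "open_bounded_op U \<longleftrightarrow> (\<forall>A\<in>U. \<forall>\<^sub>F (A', B) in uniformity. A' = A \<longrightarrow> B \<in> U)"

instance
proof
  fix A B C :: "'a bounded_op" and r s :: real and c d :: complex and U :: "'a bounded_op set"
  show "A + B + C = A + (B + C)" by transfer simp
  show "A + B = B + A" by transfer simp
  show "0 + A = A" by transfer simp
  show "- A + A = 0" by transfer simp
  show "A - B = A + - B" by transfer simp
  show "r *\<^sub>R (A + B) = r *\<^sub>R A + r *\<^sub>R B" by transfer (simp add: scaleR_add_right)
  show "(r + s) *\<^sub>R A = r *\<^sub>R A + s *\<^sub>R A" by transfer (simp add: scaleR_add_left)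
  show "r *\<^sub>R s *\<^sub>R A = (r * s) *\<^sub>R A" by transfer simp
  show "1 *\<^sub>R A = A" by transfer simp
  show "c *\<^sub>C (A + B) = c *\<^sub>C A + c *\<^sub>C B"
    by transfer (auto intro!: blinfun_eqI simp: blinfun_scaleC.rep_eq blinfun.add_left scaleC_add_right)
  show "(c + d) *\<^sub>C A = c *\<^sub>C A + d *\<^sub>C A"
    by transfer (auto intro!: blinfun_eqI simp: blinfun_scaleC.rep_eq blinfun.add_left scaleC_add_left)
  show "c *\<^sub>C d *\<^sub>C A = (c * d) *\<^sub>C A"
    by transfer (auto intro!: blinfun_eqI simp: blinfun_scaleC.rep_eq scaleC_scaleC)
  show "1 *\<^sub>C A = A"
    by transfer (auto intro!: blinfun_eqI simp: blinfun_scaleC.rep_eq scaleC_one)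
  show "r *\<^sub>R A = complex_of_real r *\<^sub>C A"
    by transfer (auto intro!: blinfun_eqI simp: blinfun_scaleC.rep_eq blinfun.scaleR_left scaleR_scaleC)
  show "A * B * C = A * (B * C)" by transfer (auto intro!: blinfun_eqI)
  show "(A + B) * C = A * C + B * C"
    by transfer (auto intro!: blinfun_eqI simp: blinfun.add_left)
  show "A * (B + C) = A * B + A * C"
    by transfer (auto intro!: blinfun_eqI simp: blinfun.add_left blinfun.add_right)
  show "(r *\<^sub>R A) * B = r *\<^sub>R (A * B)"
    by transfer (auto intro!: blinfun_eqI simp: blinfun.scaleR_left)
  show "A * (r *\<^sub>R B) = r *\<^sub>R (A * B)"
    by transfer (auto intro!: blinfun_eqI simp: blinfun.scaleR_left blinfun.scaleR_right)
  show "(c *\<^sub>C A) * B = c *\<^sub>C (A * B)"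
    by transfer (auto intro!: blinfun_eqI simp: blinfun_scaleC.rep_eq)
  show "A * (c *\<^sub>C B) = c *\<^sub>C (A * B)"
    by transfer (auto intro!: blinfun_eqI simp: blinfun_scaleC.rep_eq)
  show "dist A B = norm (A - B)" by (rule dist_bounded_op_def)
  show "sgn A = inverse (norm A) *\<^sub>R A" by (rule sgn_bounded_op_def)
  show "uniformity = (INF e\<in>{0 <..}. principal {(A, B :: 'a bounded_op). dist A B < e})"
    by (rule uniformity_bounded_op_def)
  show "open U \<longleftrightarrow> (\<forall>A\<in>U. \<forall>\<^sub>F (A', B) in uniformity. A' = A \<longrightarrow> B \<in> U)"
    by (rule open_bounded_op_def)
  show "norm A = 0 \<longleftrightarrow> A = 0" by transfer simp
  show "norm (A + B) \<le> norm A + norm B" by transfer (rule norm_triangle_ineq)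
  show "norm (r *\<^sub>R A) = \<bar>r\<bar> * norm A" by transfer simp
  show "norm (A * B) \<le> norm A * norm B" by transfer (rule norm_blinfun_compose)
  show "norm (c *\<^sub>C A) = cmod c * norm A" by transfer (rule norm_blinfun_scaleC)
qed

end

section \<open>The algebra of bounded sequences\<close>

typedef (overloaded) 'b ell_infty = "{A :: nat \<Rightarrow> 'b::real_normed_vector. bdd_above (range (\<lambda>n. norm (A n)))}"
  morphisms coord Abs_ell_infty
  by (rule exI[of _ "\<lambda>_. 0"]) simp

setup_lifting type_definition_ell_infty

instantiation ell_infty :: (complex_normed_algebra) complex_algebra
begin

lift_definition zero_ell_infty :: "'a ell_infty" is "\<lambda>_. 0"
  by simp

lift_definition plus_ell_infty :: "'a ell_infty \<Rightarrow> 'a ell_infty \<Rightarrow> 'a ell_infty" is "\<lambda>A B n. A n + B n"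
proof -
  fix A B :: "nat \<Rightarrow> 'a"
  assume "bdd_above (range (\<lambda>n. norm (A n)))" "bdd_above (range (\<lambda>n. norm (B n)))"
  then obtain K L where "norm (A n) \<le> K" "norm (B n) \<le> L" for n
    by (auto simp: bdd_above_def)
  then have "norm (A n + B n) \<le> K + L" for n
    by (intro norm_triangle_le add_mono)
  then show "bdd_above (range (\<lambda>n. norm (A n + B n)))"
    by (rule bdd_aboveI2)
qed

lift_definition uminus_ell_infty :: "'a ell_infty \<Rightarrow> 'a ell_infty" is "\<lambda>A n. - A n"
  by simp

lift_definition minus_ell_infty :: "'a ell_infty \<Rightarrow> 'a ell_infty \<Rightarrow> 'a ell_infty" is "\<lambda>A B n. A n - B n"
proof -
  fix A B :: "nat \<Rightarrow> 'a"
  assume "bdd_above (range (\<lambda>n. norm (A n)))" "bdd_above (range (\<lambda>n. norm (B n)))"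
  then obtain K L where "norm (A n) \<le> K" "norm (B n) \<le> L" for n
    by (auto simp: bdd_above_def)
  then have "norm (A n - B n) \<le> K + L" for n
    by (intro norm_triangle_le_diff add_mono)
  then show "bdd_above (range (\<lambda>n. norm (A n - B n)))"
    by (rule bdd_aboveI2)
qed

lift_definition times_ell_infty :: "'a ell_infty \<Rightarrow> 'a ell_infty \<Rightarrow> 'a ell_infty" is "\<lambda>A B n. A n * B n"
proof -
  fix A B :: "nat \<Rightarrow> 'a"
  assume "bdd_above (range (\<lambda>n. norm (A n)))" "bdd_above (range (\<lambda>n. norm (B n)))"
  then obtain K L where "norm (A n) \<le> K" "norm (B n) \<le> L" for n
    by (auto simp: bdd_above_def)
  then have "norm (A n * B n) \<le> K * L" for n
    by (intro order_trans[OF norm_mult_ineq] mult_mono' norm_ge_zero)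
  then show "bdd_above (range (\<lambda>n. norm (A n * B n)))"
    by (rule bdd_aboveI2)
qed

lift_definition scaleC_ell_infty :: "complex \<Rightarrow> 'a ell_infty \<Rightarrow> 'a ell_infty" is "\<lambda>c A n. c *\<^sub>C A n"
proof -
  fix c :: complex and A :: "nat \<Rightarrow> 'a"
  assume "bdd_above (range (\<lambda>n. norm (A n)))"
  then obtain K where "norm (A n) \<le> K" for n
    by (auto simp: bdd_above_def)
  then have "norm (c *\<^sub>C A n) \<le> cmod c * K" for n
    by (simp add: norm_scaleC mult_left_mono)
  then show "bdd_above (range (\<lambda>n. norm (c *\<^sub>C A n)))"
    by (rule bdd_aboveI2)
qed

lift_definition scaleR_ell_infty :: "real \<Rightarrow> 'a ell_infty \<Rightarrow> 'a ell_infty" is "\<lambda>r A n. r *\<^sub>R A n"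
proof -
  fix r :: real and A :: "nat \<Rightarrow> 'a"
  assume "bdd_above (range (\<lambda>n. norm (A n)))"
  then obtain K where "norm (A n) \<le> K" for n
    by (auto simp: bdd_above_def)
  then have "norm (r *\<^sub>R A n) \<le> \<bar>r\<bar> * K" for n
    by (simp add: norm_scaleR mult_left_mono)
  then show "bdd_above (range (\<lambda>n. norm (r *\<^sub>R A n)))"
    by (rule bdd_aboveI2)
qed

instance
proof
  fix A B C :: "'a ell_infty" and r s :: real and c d :: complex
  show "A + B + C = A + (B + C)" by transfer (simp add: add.assoc)
  show "A + B = B + A" by transfer (simp add: add.commute)
  show "0 + A = A" by transfer simp
  show "- A + A = 0" by transfer simp
  show "A - B = A + - B" by transfer simp
  show "r *\<^sub>R (A + B) = r *\<^sub>R A + r *\<^sub>R B" by transfer (simp add: scaleR_add_right)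
  show "(r + s) *\<^sub>R A = r *\<^sub>R A + s *\<^sub>R A" by transfer (simp add: scaleR_add_left)
  show "r *\<^sub>R s *\<^sub>R A = (r * s) *\<^sub>R A" by transfer simp
  show "1 *\<^sub>R A = A" by transfer simp
  show "c *\<^sub>C (A + B) = c *\<^sub>C A + c *\<^sub>C B" by transfer (simp add: scaleC_add_right)
  show "(c + d) *\<^sub>C A = c *\<^sub>C A + d *\<^sub>C A" by transfer (simp add: scaleC_add_left)
  show "c *\<^sub>C d *\<^sub>C A = (c * d) *\<^sub>C A" by transfer (simp add: scaleC_scaleC)
  show "1 *\<^sub>C A = A" by transfer (simp add: scaleC_one)
  show "r *\<^sub>R A = complex_of_real r *\<^sub>C A" by transfer (simp add: scaleR_scaleC)
  show "A * B * C = A * (B * C)" by transfer (simp add: mult.assoc)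
  show "(A + B) * C = A * C + B * C" by transfer (simp add: distrib_right)
  show "A * (B + C) = A * B + A * C" by transfer (simp add: distrib_left)
  show "(c *\<^sub>C A) * B = c *\<^sub>C (A * B)" by transfer (simp add: mult_scaleC_left)
  show "A * (c *\<^sub>C B) = c *\<^sub>C (A * B)" by transfer (simp add: mult_scaleC_right)
qed

end

end

theory Submission
  imports Defs
begin

text \<open>
  The idea is to play an uncountable family of almost orthogonal idempotents against separability.

  Two facts limit a Jordan homomorphism \<open>\<Phi>\<close> into the operators on a separable space. First, a
  Jordan homomorphism sends idempotents to idempotents, and it sends two idempotents whose products
  in both orders lie in its kernel to idempotents that annihilate each other
  (\<open>jordan_orthogonal_images\<close>). Secondly, on a separable space a family of nonzero pairwise
  orthogonal idempotents is countable, even though the idempotents need not be self-adjoint nor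
  uniformly bounded (\<open>orthogonal_idempotents_countable\<close>).

  Infinite dimensionality yields the family. An orthonormal basis indexed by pairs of natural
  numbers splits \<open>H\<close> into infinitely many orthogonal copies \<open>H\<^sub>0, H\<^sub>1, \<dots>\<close> of itself, so there are
  contractions \<open>V\<^sub>k, W\<^sub>k\<close> with \<open>W\<^sub>k V\<^sub>k = I\<close> and \<open>W\<^sub>j V\<^sub>k = 0\<close> for \<open>j \<noteq> k\<close>
  (\<open>separating_contractions\<close>). A function \<open>h\<close> on the natural numbers then determines the idempotent
  sequence \<open>Q\<^sub>h = (V\<^bsub>h n\<^esub> W\<^bsub>h n\<^esub>)\<^sub>n\<close>, and if \<open>h\<close> and \<open>h'\<close> agree at finitely many places only, then
  \<open>Q\<^sub>h Q\<^bsub>h'\<^esub>\<close> has only finitely many nonzero coordinates. There are uncountably many functions which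
  pairwise agree at finitely many places only (\<open>branch_code_agree_finite\<close>), so \<open>\<Phi>\<close> must vanish
  on some \<open>Q\<^sub>h\<close>.

  Finally, \<open>Q\<^sub>h\<close> is equivalent to the unit: it is \<open>V W\<close> for sequences \<open>V, W\<close> with \<open>W V = 1\<close>. A Jordan
  homomorphism that vanishes on \<open>V W\<close> vanishes on \<open>W V\<close> as well, hence everywhere
  (\<open>jordan_zero_if_unit_equivalent_zero\<close>). This last step is the reason for using idempotents
  of the form \<open>V W\<close>: central idempotents, given by almost disjoint sets of coordinates, would
  also be killed by \<open>\<Phi>\<close> for all but countably many indices, but nothing would follow about the unit.
\<close>

section \<open>Jordan homomorphisms and idempotents\<close>

lemma complex_algebra_double_zero:
  fixes x :: "'a::complex_vector"
  assumes "x + x = 0"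
  shows "x = 0"
proof -
  have "2 *\<^sub>R x = 0"
    using assms by (simp add: scaleR_2)
  then show ?thesis
    by simp
qed

lemma jordan_add:
  assumes "jordan_homomorphism \<phi>"
  shows "\<phi> (x + y) = \<phi> x + \<phi> y"
  using assms by (simp add: jordan_homomorphism_def Vector_Spaces.linear_iff)

lemma jordan_anticommutator:
  assumes J: "jordan_homomorphism \<phi>"
  shows "\<phi> (x * y + y * x) = \<phi> x * \<phi> y + \<phi> y * \<phi> x"
proof -
  have sq: "\<phi> z * \<phi> z = \<phi> (z * z)" for z
    using J by (simp add: jordan_homomorphism_def)
  have "(x + y) * (x + y) = (x * x + y * y) + (x * y + y * x)"
    by (simp add: algebra_simps)
  then have "\<phi> ((x + y) * (x + y)) = \<phi> x * \<phi> x + \<phi> y * \<phi> y + \<phi> (x * y + y * x)"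
    by (simp only: jordan_add[OF J] sq)
  moreover have "\<phi> ((x + y) * (x + y)) =
      \<phi> x * \<phi> x + \<phi> y * \<phi> y + (\<phi> x * \<phi> y + \<phi> y * \<phi> x)"
    by (simp only: sq[symmetric] jordan_add[OF J]) (simp add: algebra_simps)
  ultimately show ?thesis
    by simp
qed

text \<open>Multiplying \<open>p q + q p = 0\<close> by \<open>p\<close> on either side identifies both \<open>p q\<close> and \<open>q p\<close> with
  \<open>- p q p\<close>; the two products then agree and sum to zero.\<close>

lemma anticommuting_idempotent_orthogonal:
  fixes p q :: "'a::complex_algebra"
  assumes "p * p = p" and anti: "p * q + q * p = 0"
  shows "p * q = 0"
proof -
  have "p * (p * q + q * p) = p * p * q + p * q * p"
    and "(p * q + q * p) * p = p * q * p + q * (p * p)"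
    by (simp_all add: algebra_simps)
  then have "p * q + p * q * p = 0" and "p * q * p + q * p = 0"
    using assms by simp_all
  then have "p * q = q * p"
    by (metis add.commute add_left_cancel)
  then show ?thesis
    using anti complex_algebra_double_zero by metis
qed

lemma jordan_orthogonal_images:
  assumes J: "jordan_homomorphism \<phi>"
    and "p * p = p" and "\<phi> (p * q) = 0" and "\<phi> (q * p) = 0"
  shows "\<phi> p * \<phi> q = 0"
proof (rule anticommuting_idempotent_orthogonal)
  show "\<phi> p * \<phi> p = \<phi> p"
    using J assms(2) by (simp add: jordan_homomorphism_def)
  show "\<phi> p * \<phi> q + \<phi> q * \<phi> p = 0"
    using jordan_anticommutator[OF J, of p q] assms(3,4) by (simp add: jordan_add[OF J])
qed

text \<open>Let \<open>q = v w\<close>, an idempotent with \<open>q v = v\<close>. Since \<open>\<phi> q = 0\<close>, the map \<open>\<phi>\<close> kills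
  \<open>q y + y q\<close> for every \<open>y\<close>. For \<open>y = v q\<close> this sum is \<open>2 v q\<close>, and for \<open>y = v\<close> it is \<open>v + v q\<close>, so
  \<open>\<phi>\<close> kills \<open>v q\<close> and then \<open>v\<close>. Hence it kills \<open>v w + w v\<close>, and with it the unit \<open>w v\<close>.\<close>

lemma jordan_zero_if_unit_equivalent_zero:
  assumes J: "jordan_homomorphism \<phi>"
    and unit: "\<And>x. w * v * x = x" "\<And>x. x * (w * v) = x"
    and zero: "\<phi> (v * w) = 0"
  shows "\<phi> x = 0"
proof -
  define q where "q = v * w"
  have q0: "\<phi> q = 0"
    using zero by (simp add: q_def)
  have kill: "\<phi> (q * y + y * q) = 0" for y
    using jordan_anticommutator[OF J, of q y] q0 by simp
  have qv: "q * v = v"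
    using unit(2)[of v] by (simp add: q_def mult.assoc)
  have qq: "q * q = q"
    using qv by (simp add: q_def mult.assoc[symmetric])
  have "q * (v * q) = v * q" "v * q * q = v * q"
    by (simp add: mult.assoc[symmetric] qv) (simp add: mult.assoc qq)
  then have "\<phi> (v * q) + \<phi> (v * q) = 0"
    using kill[of "v * q"] by (simp add: jordan_add[OF J])
  then have "\<phi> (v * q) = 0"
    by (rule complex_algebra_double_zero)
  then have "\<phi> v = 0"
    using kill[of v] by (simp add: qv jordan_add[OF J])
  then have u0: "\<phi> (w * v) = 0"
    using jordan_anticommutator[OF J, of v w] zero by (simp add: jordan_add[OF J])
  have "\<phi> x + \<phi> x = \<phi> (w * v * x + x * (w * v))"
    by (simp only: unit jordan_add[OF J])
  also have "\<dots> = 0"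
    by (simp only: jordan_anticommutator[OF J] u0) simp
  finally show ?thesis
    by (rule complex_algebra_double_zero)
qed

section \<open>Separability and orthogonal families\<close>

lemma separable_separated_family_countable:
  fixes x :: "'i \<Rightarrow> 'a::metric_space"
  assumes sep: "separable_space (euclidean :: 'a topology)"
    and "\<delta> > 0"
    and far: "\<And>i j. i \<in> I \<Longrightarrow> j \<in> I \<Longrightarrow> i \<noteq> j \<Longrightarrow> \<delta> \<le> dist (x i) (x j)"
  shows "countable I"
proof -
  obtain D :: "'a set" where D: "countable D" "closure D = UNIV"
    using sep unfolding separable_space_def by auto
  have "\<exists>d\<in>D. dist d y < \<delta> / 2" for y
    using D(2) \<open>\<delta> > 0\<close> closure_approachable[of y D] by (metis UNIV_I half_gt_zero)
  then obtain d where d: "\<And>y. d y \<in> D" "\<And>y. dist (d y) y < \<delta> / 2"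
    by metis
  have "inj_on (\<lambda>i. d (x i)) I"
  proof (rule inj_onI, rule ccontr)
    fix i j assume ij: "i \<in> I" "j \<in> I" "d (x i) = d (x j)" "i \<noteq> j"
    have "dist (x i) (x j) \<le> dist (d (x i)) (x i) + dist (d (x i)) (x j)"
      by (metis dist_commute dist_triangle)
    also have "\<dots> < \<delta>"
      using d(2)[of "x i"] d(2)[of "x j"] ij(3) by simp
    finally show False
      using far[OF ij(1,2,4)] by simp
  qed
  moreover have "countable ((\<lambda>i. d (x i)) ` I)"
    using D(1) d(1) by (meson countable_subset image_subsetI)
  ultimately show ?thesis
    by (rule countable_image_inj_on[rotated])
qed

abbreviation op_apply :: "'a::complex_hilbert_space bounded_op \<Rightarrow> 'a \<Rightarrow> 'a"
  where "op_apply A x \<equiv> blinfun_apply (blinfun_of_op A) x"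

lemma op_apply_times: "op_apply (A * B) x = op_apply A (op_apply B x)"
  by (simp add: times_bounded_op.rep_eq)

lemma op_apply_zero: "op_apply 0 x = 0"
  by (simp add: zero_bounded_op.rep_eq)

lemma op_eqI: "(\<And>x. op_apply A x = op_apply B x) \<Longrightarrow> A = B"
  by (simp add: blinfun_eqI flip: blinfun_of_op_inject)

lemma norm_op_apply: "norm (op_apply A x) \<le> norm A * norm x"
  by (simp add: norm_bounded_op.rep_eq norm_blinfun)

text \<open>A vector in the range of \<open>P i\<close> may be scaled to have norm \<open>norm (P i)\<close>. As \<open>P i\<close> fixes its own
  vector and annihilates the others, it maps a difference of two such vectors to a vector of
  norm \<open>norm (P i)\<close>, so that the difference has norm at least \<open>1\<close>: the vectors are separated although
  the norms of the idempotents may be unbounded.\<close>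

lemma orthogonal_idempotents_countable:
  fixes P :: "'i \<Rightarrow> 'a::complex_hilbert_space bounded_op"
  assumes sep: "separable_space (euclidean :: 'a topology)"
    and idem: "\<And>i. i \<in> I \<Longrightarrow> P i * P i = P i"
    and nz: "\<And>i. i \<in> I \<Longrightarrow> P i \<noteq> 0"
    and orth: "\<And>i j. i \<in> I \<Longrightarrow> j \<in> I \<Longrightarrow> i \<noteq> j \<Longrightarrow> P i * P j = 0"
  shows "countable I"
proof -
  have "\<exists>x. op_apply (P i) x = x \<and> norm x = norm (P i)" if "i \<in> I" for i
  proof -
    have "\<exists>z. op_apply (P i) z \<noteq> 0"
      using nz[OF that] op_eqI[of "P i" 0] by (auto simp: op_apply_zero)
    then obtain z where z: "op_apply (P i) z \<noteq> 0" ..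
    define y where "y = op_apply (P i) z"
    have "op_apply (P i) y = y"
      using idem[OF that] op_apply_times[of "P i" "P i" z] by (simp add: y_def)
    then have "op_apply (P i) ((norm (P i) / norm y) *\<^sub>R y) = (norm (P i) / norm y) *\<^sub>R y"
      by (simp add: blinfun.scaleR_right)
    moreover have "norm ((norm (P i) / norm y) *\<^sub>R y) = norm (P i)"
      using z by (simp add: y_def)
    ultimately show ?thesis
      by blast
  qed
  then obtain x where
    x: "\<And>i. i \<in> I \<Longrightarrow> op_apply (P i) (x i) = x i" "\<And>i. i \<in> I \<Longrightarrow> norm (x i) = norm (P i)"
    by metis
  show ?thesis
  proof (rule separable_separated_family_countable[OF sep zero_less_one])
    fix i j assume ij: "i \<in> I" "j \<in> I" "i \<noteq> j"
    have "op_apply (P i) (x j) = op_apply (P i * P j) (x j)"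
      by (simp add: op_apply_times x(1) ij)
    then have "op_apply (P i) (x i - x j) = x i"
      by (simp add: orth[OF ij] op_apply_zero blinfun.diff_right x(1) ij)
    then have "norm (P i) \<le> norm (P i) * norm (x i - x j)"
      using norm_op_apply[of "P i" "x i - x j"] x(2)[OF ij(1)] by simp
    moreover have "norm (P i) > 0"
      using nz[OF ij(1)] by simp
    ultimately show "1 \<le> dist (x i) (x j)"
      by (simp add: dist_norm)
  qed
qed

section \<open>Orthonormal families\<close>

lemma cinner_add_right: "cinner x (y + z) = cinner x y + cinner x z"
  by (metis cinner_add_left cinner_commute complex_cnj_add)

lemma cinner_scaleC_right: "cinner x (c *\<^sub>C y) = cnj c * cinner x y"
  by (metis cinner_commute cinner_scaleC_left complex_cnj_mult)

lemma cinner_zero_left [simp]: "cinner 0 x = 0"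
  using cinner_add_left[of 0 0 x] by simp

lemma cinner_zero_right [simp]: "cinner x 0 = 0"
  by (metis cinner_commute cinner_zero_left complex_cnj_zero)

lemma cinner_diff_left: "cinner (x - y) z = cinner x z - cinner y z"
  using cinner_add_left[of "x - y" y z] by simp

lemma cinner_sum_left: "cinner (sum f S) y = (\<Sum>i\<in>S. cinner (f i) y)"
  by (induction S rule: infinite_finite_induct) (simp_all add: cinner_add_left)

lemma cinner_sum_right: "cinner y (sum f S) = (\<Sum>i\<in>S. cinner y (f i))"
  by (induction S rule: infinite_finite_induct) (simp_all add: cinner_add_right)

lemma cinner_self: "cinner x x = complex_of_real ((norm x)\<^sup>2)"
proof (rule complex_eqI)
  show "Re (cinner x x) = Re (complex_of_real ((norm x)\<^sup>2))"
    by (simp add: norm_eq_sqrt_cinner cinner_self_nonneg)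
  show "Im (cinner x x) = Im (complex_of_real ((norm x)\<^sup>2))"
    using arg_cong[OF cinner_commute[of x x], of Im] by simp
qed

definition orthonormal :: "('i \<Rightarrow> 'a::complex_hilbert_space) \<Rightarrow> 'i set \<Rightarrow> bool" where
  "orthonormal e S \<longleftrightarrow> (\<forall>i\<in>S. \<forall>j\<in>S. cinner (e i) (e j) = (if i = j then 1 else 0))"

lemma orthonormalD:
  "orthonormal e S \<Longrightarrow> i \<in> S \<Longrightarrow> j \<in> S \<Longrightarrow> cinner (e i) (e j) = (if i = j then 1 else 0)"
  by (simp add: orthonormal_def)

lemma orthonormal_comp_inj: "orthonormal e UNIV \<Longrightarrow> inj s \<Longrightarrow> orthonormal (\<lambda>n. e (s n)) UNIV"
  by (simp add: orthonormal_def inj_eq)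

lemma cinner_orthonormal_sum:
  assumes "orthonormal e F" "finite F" "j \<in> F"
  shows "cinner (\<Sum>i\<in>F. c i *\<^sub>C e i) (e j) = c j"
proof -
  have "cinner (\<Sum>i\<in>F. c i *\<^sub>C e i) (e j) = (\<Sum>i\<in>F. if i = j then c i else 0)"
    unfolding cinner_sum_left
    by (rule sum.cong) (simp_all add: cinner_scaleC_left orthonormalD[OF assms(1) _ assms(3)])
  then show ?thesis
    using assms by simp
qed

lemma norm_orthonormal_sum:
  assumes "orthonormal e F" "finite F"
  shows "(norm (\<Sum>i\<in>F. c i *\<^sub>C e i))\<^sup>2 = (\<Sum>i\<in>F. (cmod (c i))\<^sup>2)"
proof -
  let ?s = "\<Sum>i\<in>F. c i *\<^sub>C e i"
  have "cinner ?s ?s = (\<Sum>j\<in>F. cnj (c j) * cinner ?s (e j))"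
    by (subst cinner_sum_right) (simp add: cinner_scaleC_right)
  also have "\<dots> = (\<Sum>j\<in>F. complex_of_real ((cmod (c j))\<^sup>2))"
    by (rule sum.cong)
      (simp_all add: cinner_orthonormal_sum[OF assms] complex_norm_square mult.commute
        del: of_real_power)
  finally have "complex_of_real ((norm ?s)\<^sup>2) = complex_of_real (\<Sum>i\<in>F. (cmod (c i))\<^sup>2)"
    by (simp add: cinner_self)
  then show ?thesis
    by (simp only: of_real_eq_iff)
qed

lemma bessel_inequality:
  assumes "orthonormal e F" "finite F"
  shows "(\<Sum>i\<in>F. (cmod (cinner x (e i)))\<^sup>2) \<le> (norm x)\<^sup>2"
proof -
  define s where "s = (\<Sum>i\<in>F. cinner x (e i) *\<^sub>C e i)"
  have s: "(norm s)\<^sup>2 = (\<Sum>i\<in>F. (cmod (cinner x (e i)))\<^sup>2)"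
    unfolding s_def by (rule norm_orthonormal_sum[OF assms])
  have "cinner (x - s) s = 0"
  proof -
    have "cinner (x - s) s = (\<Sum>j\<in>F. cnj (cinner x (e j)) * cinner (x - s) (e j))"
      by (subst (2) s_def) (simp add: cinner_sum_right cinner_scaleC_right)
    also have "\<dots> = 0"
      by (rule sum.neutral) (simp add: cinner_diff_left s_def cinner_orthonormal_sum[OF assms])
    finally show ?thesis .
  qed
  moreover from this have "cinner s (x - s) = 0"
    by (metis cinner_commute complex_cnj_zero)
  ultimately have "cinner ((x - s) + s) ((x - s) + s) = cinner (x - s) (x - s) + cinner s s"
    by (simp only: cinner_add_left cinner_add_right) simp
  then have "complex_of_real ((norm x)\<^sup>2) = complex_of_real ((norm (x - s))\<^sup>2 + (norm s)\<^sup>2)"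
    by (simp add: cinner_self)
  then have "(norm x)\<^sup>2 = (norm (x - s))\<^sup>2 + (norm s)\<^sup>2"
    by (simp only: of_real_eq_iff)
  then show ?thesis
    using s by simp
qed

lemma cinner_normalized_self:
  fixes x :: "'a::complex_hilbert_space"
  assumes "x \<noteq> 0"
  shows "cinner (inverse (norm x) *\<^sub>R x) (inverse (norm x) *\<^sub>R x) = 1"
  using assms by (simp add: cinner_self)

text \<open>The Cauchy-Schwarz inequality is the inequality of Bessel for a single normalised vector.\<close>

lemma cinner_cauchy_schwarz: "cmod (cinner x y) \<le> norm x * norm y"
proof (cases "y = 0")
  case False
  define u where "u = inverse (norm y) *\<^sub>R y"
  have "orthonormal (\<lambda>_. u) {()}"
    using cinner_normalized_self[OF False] by (simp add: orthonormal_def u_def)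
  then have "(cmod (cinner x u))\<^sup>2 \<le> (norm x)\<^sup>2"
    using bessel_inequality[of "\<lambda>_. u" "{()}" x] by simp
  then have "cmod (cinner x u) \<le> norm x"
    by (rule power2_le_imp_le) simp
  moreover have "cmod (cinner x u) = inverse (norm y) * cmod (cinner x y)"
    by (simp add: u_def scaleR_scaleC cinner_scaleC_right norm_mult norm_inverse)
  ultimately show ?thesis
    using False by (simp add: field_simps)
qed simp

lemma bounded_linear_cinner_left: "bounded_linear (\<lambda>x. cinner x y)"
  by (rule bounded_linear_intro[where K = "norm y"])
    (simp_all add: cinner_add_left scaleR_scaleC cinner_scaleC_left cinner_cauchy_schwarz
      scaleR_conv_of_real)

text \<open>An orthonormal basis is obtained as a maximal orthonormal set: it is countable because its
  elements are uniformly separated, and infinite because a finite one would span.\<close>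

lemma orthonormal_basis_sequence:
  assumes sep: "separable_space (euclidean :: 'a::complex_hilbert_space topology)"
    and inf: "infinite_dimensional TYPE('a)"
  obtains e :: "nat \<Rightarrow> 'a::complex_hilbert_space" where "orthonormal e UNIV"
    and "\<And>x. (\<And>n. cinner x (e n) = 0) \<Longrightarrow> x = 0"
proof -
  let ?A = "{B :: 'a set. orthonormal id B}"
  have "\<exists>M\<in>?A. \<forall>X\<in>?A. M \<subseteq> X \<longrightarrow> X = M"
  proof (rule subset_Zorn')
    fix C assume C: "subset.chain ?A C"
    have "cinner b c = (if b = c then 1 else 0)" if bc: "b \<in> \<Union>C" "c \<in> \<Union>C" for b c
    proof -
      obtain X Y where "X \<in> C" "b \<in> X" "Y \<in> C" "c \<in> Y"
        using bc by blast
      then obtain Z where "Z \<in> C" "b \<in> Z" "c \<in> Z"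
        using C unfolding subset_chain_def by blast
      then show ?thesis
        using C orthonormalD[of id Z b c] unfolding subset_chain_def by auto
    qed
    then show "\<Union>C \<in> ?A"
      by (simp add: orthonormal_def)
  qed
  then obtain B :: "'a set" where B: "orthonormal id B"
    and max: "\<And>X. orthonormal id X \<Longrightarrow> B \<subseteq> X \<Longrightarrow> X = B"
    by auto
  have total: "x = 0" if x: "\<And>b. b \<in> B \<Longrightarrow> cinner x b = 0" for x
  proof (rule ccontr)
    assume "x \<noteq> 0"
    define u where "u = inverse (norm x) *\<^sub>R x"
    have uu: "cinner u u = 1"
      unfolding u_def by (rule cinner_normalized_self[OF \<open>x \<noteq> 0\<close>])
    have ub: "cinner u b = 0" "cinner b u = 0" if "b \<in> B" for b
    proof -
      show *: "cinner u b = 0"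
        by (simp add: u_def scaleR_scaleC cinner_scaleC_left x[OF that])
      show "cinner b u = 0"
        by (metis * cinner_commute complex_cnj_zero)
    qed
    have "orthonormal id (insert u B)"
      using B uu ub by (auto simp: orthonormal_def)
    then have "u \<in> B"
      using max by blast
    then show False
      using ub uu by simp
  qed
  have "infinite B"
  proof
    assume fin: "finite B"
    have "x \<in> complex_span B" for x
    proof -
      define s where "s = (\<Sum>b\<in>B. cinner x b *\<^sub>C b)"
      have "cinner (x - s) b = 0" if "b \<in> B" for b
        using cinner_orthonormal_sum[OF B fin that, of "cinner x"]
        by (simp add: s_def cinner_diff_left)
      then have "x = s"
        using total[of "x - s"] by simp
      then show ?thesis
        unfolding s_def
        by (metis (no_types, lifting) complex_vector.span_base complex_vector.span_scale
            complex_vector.span_sum)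
    qed
    then show False
      using inf fin unfolding infinite_dimensional_def by blast
  qed
  have "countable B"
  proof (rule separable_separated_family_countable[OF sep zero_less_one, where x = id])
    fix b c assume bc: "b \<in> B" "c \<in> B" "b \<noteq> c"
    have "cinner (b - c) b = 1"
      using orthonormalD[OF B bc(1,1)] orthonormalD[OF B bc(2,1)] bc(3)
      by (simp add: cinner_diff_left)
    then have "1 \<le> norm (b - c) * norm b"
      using cinner_cauchy_schwarz[of "b - c" b] by simp
    moreover have "norm b = 1"
      using orthonormalD[OF B bc(1,1)] by (simp add: norm_eq_sqrt_cinner)
    ultimately show "1 \<le> dist (id b) (id c)"
      by (simp add: dist_norm)
  qed
  then have bij: "bij_betw (from_nat_into B) UNIV B"
    using \<open>infinite B\<close> by (rule bij_betw_from_nat_into)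
  show ?thesis
  proof (rule that[of "from_nat_into B"])
    show "orthonormal (from_nat_into B) UNIV"
      unfolding orthonormal_def
    proof (intro ballI)
      fix i j :: nat
      have "from_nat_into B i \<in> B" "from_nat_into B j \<in> B"
        "from_nat_into B i = from_nat_into B j \<longleftrightarrow> i = j"
        using bij by (auto simp: bij_betw_def inj_eq)
      then show "cinner (from_nat_into B i) (from_nat_into B j) = (if i = j then 1 else 0)"
        using orthonormalD[OF B, of "from_nat_into B i" "from_nat_into B j"] by simp
    qed
    show "x = 0" if "\<And>n. cinner x (from_nat_into B n) = 0" for x
      using total that bij unfolding bij_betw_def by (metis rangeE)
  qed
qed

section \<open>Partial isometries between orthonormal sequences\<close>

text \<open>For orthonormal \<open>e\<close> and \<open>f\<close>, this is the partial isometry that sends \<open>e n\<close> to \<open>f n\<close> and vanishes on the orthogonal complement of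
  the sequence \<open>e\<close>. Its adjoint is obtained by exchanging \<open>e\<close> and \<open>f\<close>, so that adjoints need not be
  introduced.\<close>

definition basis_map :: "(nat \<Rightarrow> 'a::complex_hilbert_space) \<Rightarrow> (nat \<Rightarrow> 'a) \<Rightarrow> 'a \<Rightarrow> 'a" where
  "basis_map e f x = (\<Sum>n. cinner x (e n) *\<^sub>C f n)"

definition basis_op :: "(nat \<Rightarrow> 'a::complex_hilbert_space) \<Rightarrow> (nat \<Rightarrow> 'a) \<Rightarrow> 'a bounded_op" where
  "basis_op e f = Abs_bounded_op (Blinfun (basis_map e f))"

lemma basis_map_partial_sum_le:
  fixes e f :: "nat \<Rightarrow> 'a::complex_hilbert_space"
  assumes e: "orthonormal e UNIV" and f: "orthonormal f UNIV"
  shows "norm (\<Sum>n<k. cinner x (e n) *\<^sub>C f n) \<le> norm x"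
proof -
  have "orthonormal e {..<k}" "orthonormal f {..<k}"
    using e f by (simp_all add: orthonormal_def)
  then have "(norm (\<Sum>n<k. cinner x (e n) *\<^sub>C f n))\<^sup>2 \<le> (norm x)\<^sup>2"
    by (simp only: norm_orthonormal_sum bessel_inequality finite_lessThan)
  then show ?thesis
    by (rule power2_le_imp_le) simp
qed

text \<open>By orthonormality of \<open>f\<close>, the Cauchy criterion for the vector series is the Cauchy criterion for
  the scalar series of Bessel.\<close>

lemma basis_map_summable:
  fixes e f :: "nat \<Rightarrow> 'a::complex_hilbert_space"
  assumes e: "orthonormal e UNIV" and f: "orthonormal f UNIV"
  shows "summable (\<lambda>n. cinner x (e n) *\<^sub>C f n)"
proof -
  let ?a = "\<lambda>n. (cmod (cinner x (e n)))\<^sup>2"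
  have sa: "summable ?a"
  proof (rule summableI_nonneg_bounded)
    fix k
    have "orthonormal e {..<k}"
      using e by (simp add: orthonormal_def)
    then show "sum ?a {..<k} \<le> (norm x)\<^sup>2"
      by (rule bessel_inequality) simp
  qed simp
  show ?thesis
    unfolding summable_Cauchy
  proof (intro allI impI)
    fix \<epsilon> :: real assume "\<epsilon> > 0"
    then obtain N where N: "\<And>m n. m \<ge> N \<Longrightarrow> norm (sum ?a {m..<n}) < \<epsilon>\<^sup>2"
      using sa unfolding summable_Cauchy by (meson zero_less_power)
    have "norm (\<Sum>i=m..<n. cinner x (e i) *\<^sub>C f i) < \<epsilon>" if "m \<ge> N" for m n
    proof -
      have "orthonormal f {m..<n}"
        using f by (simp add: orthonormal_def)
      then have "(norm (\<Sum>i=m..<n. cinner x (e i) *\<^sub>C f i))\<^sup>2 = sum ?a {m..<n}"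
        by (simp add: norm_orthonormal_sum)
      also have "\<dots> < \<epsilon>\<^sup>2"
        using N[OF that, of n] by simp
      finally show ?thesis
        by (rule power_less_imp_less_base) (use \<open>\<epsilon> > 0\<close> in simp)
    qed
    then show "\<exists>N. \<forall>m\<ge>N. \<forall>n. norm (\<Sum>i=m..<n. cinner x (e i) *\<^sub>C f i) < \<epsilon>"
      by blast
  qed
qed

lemma norm_basis_map_le:
  assumes "orthonormal e UNIV" "orthonormal f UNIV"
  shows "norm (basis_map e f x) \<le> norm x"
proof (rule LIMSEQ_le_const2)
  show "(\<lambda>k. norm (\<Sum>n<k. cinner x (e n) *\<^sub>C f n)) \<longlonglongrightarrow> norm (basis_map e f x)"
    unfolding basis_map_def
    by (intro tendsto_norm summable_LIMSEQ basis_map_summable assms)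
qed (use basis_map_partial_sum_le[OF assms] in blast)

lemma basis_map_add:
  assumes "orthonormal e UNIV" "orthonormal f UNIV"
  shows "basis_map e f (x + y) = basis_map e f x + basis_map e f y"
  unfolding basis_map_def
  by (subst suminf_add[OF basis_map_summable[OF assms] basis_map_summable[OF assms]])
    (simp add: cinner_add_left scaleC_add_left)

lemma basis_map_scaleC:
  assumes "orthonormal e UNIV" "orthonormal f UNIV"
  shows "basis_map e f (c *\<^sub>C x) = c *\<^sub>C basis_map e f x"
  unfolding basis_map_def
  by (subst bounded_linear.suminf[OF bounded_linear_scaleC_hilbert basis_map_summable[OF assms]])
    (simp add: cinner_scaleC_left scaleC_scaleC)

lemma bounded_linear_basis_map:
  assumes "orthonormal e UNIV" "orthonormal f UNIV"
  shows "bounded_linear (basis_map e f)"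
  by (rule bounded_linear_intro[where K = 1])
    (simp_all add: basis_map_add[OF assms] basis_map_scaleC[OF assms] scaleR_scaleC
      norm_basis_map_le[OF assms])

lemma basis_op_apply:
  assumes "orthonormal e UNIV" "orthonormal f UNIV"
  shows "op_apply (basis_op e f) = basis_map e f"
  unfolding basis_op_def
  by (subst Abs_bounded_op_inverse)
    (simp_all add: bounded_linear_Blinfun_apply[OF bounded_linear_basis_map[OF assms]]
      basis_map_scaleC[OF assms])

lemma norm_basis_op_le:
  assumes "orthonormal e UNIV" "orthonormal f UNIV"
  shows "norm (basis_op e f) \<le> 1"
  unfolding norm_bounded_op.rep_eq
  by (rule norm_blinfun_bound) (simp_all add: basis_op_apply[OF assms] norm_basis_map_le[OF assms])

lemma cinner_basis_map:
  assumes "orthonormal e UNIV" "orthonormal f UNIV"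
  shows "cinner (basis_map e f x) y = (\<Sum>n. cinner x (e n) * cinner (f n) y)"
  unfolding basis_map_def
  by (subst bounded_linear.suminf[OF bounded_linear_cinner_left basis_map_summable[OF assms]])
    (simp add: cinner_scaleC_left)

lemma cinner_basis_map_same:
  assumes "orthonormal e UNIV" "orthonormal f UNIV"
  shows "cinner (basis_map e f x) (f m) = cinner x (e m)"
proof -
  have "(\<Sum>n. cinner x (e n) * cinner (f n) (f m)) =
      (\<Sum>n\<in>{m}. cinner x (e n) * cinner (f n) (f m))"
    by (rule suminf_finite) (simp_all add: orthonormalD[OF assms(2)])
  then show ?thesis
    by (simp add: cinner_basis_map[OF assms] orthonormalD[OF assms(2)])
qed

lemma basis_op_times_same:
  assumes "orthonormal e UNIV" "orthonormal f UNIV" "orthonormal g UNIV"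
  shows "basis_op f g * basis_op e f = basis_op e g"
proof (rule op_eqI)
  fix x
  have "basis_map f g (basis_map e f x) = basis_map e g x"
    by (subst (1 3) basis_map_def) (simp add: cinner_basis_map_same assms)
  then show "op_apply (basis_op f g * basis_op e f) x = op_apply (basis_op e g) x"
    by (simp add: op_apply_times basis_op_apply assms)
qed

lemma basis_op_times_orthogonal:
  assumes "orthonormal e UNIV" "orthonormal f UNIV" "orthonormal f' UNIV" "orthonormal g UNIV"
    and orth: "\<And>m n. cinner (f m) (f' n) = 0"
  shows "basis_op f' g * basis_op e f = 0"
proof (rule op_eqI)
  fix x
  have "basis_map f' g (basis_map e f x) = 0"
    by (subst basis_map_def) (simp add: cinner_basis_map assms)
  then show "op_apply (basis_op f' g * basis_op e f) x = op_apply 0 x"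
    by (simp add: op_apply_times op_apply_zero basis_op_apply assms)
qed

text \<open>The vector \<open>x\<close> and its image have the same coefficients with respect to \<open>e\<close>.\<close>

lemma basis_op_total:
  assumes e: "orthonormal e UNIV" and total: "\<And>x. (\<And>n. cinner x (e n) = 0) \<Longrightarrow> x = 0"
  shows "op_apply (basis_op e e) x = x"
proof -
  have "cinner (basis_map e e x - x) (e n) = 0" for n
    by (simp add: cinner_diff_left cinner_basis_map_same[OF e e])
  then have "basis_map e e x - x = 0"
    by (rule total)
  then show ?thesis
    by (simp add: basis_op_apply[OF e e])
qed

text \<open>Splitting the basis into the infinitely many rows \<open>(k, 0), (k, 1), \<dots>\<close>, the operator \<open>V k\<close>
  identifies the space with the closed span of row \<open>k\<close>, and \<open>W k\<close> is its adjoint. The uniform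
  bound on the norms lets any choice of indices define a bounded sequence.\<close>

lemma separating_contractions:
  assumes sep: "separable_space (euclidean :: 'a::complex_hilbert_space topology)"
    and inf: "infinite_dimensional TYPE('a)"
  obtains V W :: "nat \<Rightarrow> 'a::complex_hilbert_space bounded_op"
  where "\<And>k. norm (V k) \<le> 1" "\<And>k. norm (W k) \<le> 1"
    and "\<And>k A. W k * V k * A = A" "\<And>k A. A * (W k * V k) = A"
    and "\<And>j k. j \<noteq> k \<Longrightarrow> W j * V k = 0"
proof -
  obtain e :: "nat \<Rightarrow> 'a" where e: "orthonormal e UNIV"
    and total: "\<And>x. (\<And>n. cinner x (e n) = 0) \<Longrightarrow> x = 0"
    using orthonormal_basis_sequence[OF sep inf] by blast
  define r where "r k n = e (prod_encode (k, n))" for k n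
  have r: "orthonormal (r k) UNIV" for k
    unfolding r_def by (rule orthonormal_comp_inj[OF e]) (auto intro: injI)
  have rr: "cinner (r k m) (r j n) = 0" if "j \<noteq> k" for j k m n
    using that by (simp add: r_def orthonormalD[OF e])
  have WV: "op_apply (basis_op (r k) e * basis_op e (r k)) x = x" for k x
    by (simp add: basis_op_times_same[OF e r e] basis_op_total[OF e total])
  show ?thesis
  proof (rule that[of "\<lambda>k. basis_op e (r k)" "\<lambda>k. basis_op (r k) e"])
    show "norm (basis_op e (r k)) \<le> 1" "norm (basis_op (r k) e) \<le> 1" for k
      by (simp_all add: norm_basis_op_le e r)
    show "basis_op (r k) e * basis_op e (r k) * A = A" for k A
      using WV by (intro op_eqI) (simp add: op_apply_times)
    show "A * (basis_op (r k) e * basis_op e (r k)) = A" for k A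
      using WV by (intro op_eqI) (simp add: op_apply_times)
    show "basis_op (r j) e * basis_op e (r k) = 0" if "j \<noteq> k" for j k
      by (rule basis_op_times_orthogonal[OF e r r e rr[OF that]])
  qed
qed

section \<open>Almost disjoint functions\<close>

text \<open>A set of natural numbers is a branch of the binary tree, and \<open>branch_code S n\<close> names the node of
  that branch at level \<open>n\<close>: uncountably many branches, any two of which part for good at some
  level.\<close>

definition branch_code :: "nat set \<Rightarrow> nat \<Rightarrow> nat" where
  "branch_code S n = to_nat (map (\<lambda>i. i \<in> S) [0..<n])"

lemma branch_code_agree_finite:
  assumes "S \<noteq> T"
  shows "finite {n. branch_code S n = branch_code T n}"
proof -
  obtain i where i: "(i \<in> S) \<noteq> (i \<in> T)"
    using assms by blast
  have "n \<le> i" if "branch_code S n = branch_code T n" for n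
  proof (rule ccontr)
    assume "\<not> n \<le> i"
    moreover have "map (\<lambda>i. i \<in> S) [0..<n] = map (\<lambda>i. i \<in> T) [0..<n]"
      using that by (simp add: branch_code_def)
    ultimately show False
      using i by (auto simp: map_eq_conv)
  qed
  then have "{n. branch_code S n = branch_code T n} \<subseteq> {..i}"
    by auto
  then show ?thesis
    by (rule finite_subset) simp
qed

lemma uncountable_nat_sets: "uncountable (UNIV :: nat set set)"
proof
  assume "countable (UNIV :: nat set set)"
  then have "range (from_nat_into (UNIV :: nat set set)) = Pow UNIV"
    by (simp add: range_from_nat_into)
  then show False
    using Cantors_theorem by blast
qed

section \<open>The algebra of bounded sequences\<close>

lemma ell_infty_eqI: "(\<And>n. coord A n = coord B n) \<Longrightarrow> A = B"
  by (simp add: fun_eq_iff flip: coord_inject)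

lemma coord_times: "coord (A * B) n = coord A n * coord B n"
  for A B :: "'b::complex_normed_algebra ell_infty"
  by (simp add: times_ell_infty.rep_eq)

lemma coord_Abs_ell_infty:
  assumes "\<And>n. norm (A n) \<le> K"
  shows "coord (Abs_ell_infty A) = A"
  using assms by (intro Abs_ell_infty_inverse CollectI bdd_aboveI2)

theorem theorem1:
  assumes "separable_space (euclidean :: 'a::complex_hilbert_space topology)"
    and "infinite_dimensional TYPE('a)"
  shows "\<not> (\<exists>\<Phi> :: 'a bounded_op ell_infty \<Rightarrow> 'a bounded_op.
            jordan_homomorphism \<Phi> \<and> \<Phi> \<noteq> (\<lambda>_. 0) \<and>
            (\<forall>A. finite {n. coord A n \<noteq> 0} \<longrightarrow> \<Phi> A = 0))"
proof
  assume "\<exists>\<Phi> :: 'a bounded_op ell_infty \<Rightarrow> 'a bounded_op.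
            jordan_homomorphism \<Phi> \<and> \<Phi> \<noteq> (\<lambda>_. 0) \<and>
            (\<forall>A. finite {n. coord A n \<noteq> 0} \<longrightarrow> \<Phi> A = 0)"
  then obtain \<Phi> :: "'a bounded_op ell_infty \<Rightarrow> 'a bounded_op" where
    J: "jordan_homomorphism \<Phi>" and nz: "\<Phi> \<noteq> (\<lambda>_. 0)"
    and van: "\<And>A. finite {n. coord A n \<noteq> 0} \<Longrightarrow> \<Phi> A = 0"
    by blast
  obtain V W :: "nat \<Rightarrow> 'a bounded_op"
    where bound: "\<And>k. norm (V k) \<le> 1" "\<And>k. norm (W k) \<le> 1"
      and unit: "\<And>k A. W k * V k * A = A" "\<And>k A. A * (W k * V k) = A"
      and orth: "\<And>j k. j \<noteq> k \<Longrightarrow> W j * V k = 0"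
    using separating_contractions[OF assms] by blast
  define v where "v S = Abs_ell_infty (\<lambda>n. V (branch_code S n))" for S
  define w where "w S = Abs_ell_infty (\<lambda>n. W (branch_code S n))" for S
  define q where "q S = v S * w S" for S
  have coord_v: "coord (v S) n = V (branch_code S n)" for S n
    unfolding v_def using bound(1) by (subst coord_Abs_ell_infty) auto
  have coord_w: "coord (w S) n = W (branch_code S n)" for S n
    unfolding w_def using bound(2) by (subst coord_Abs_ell_infty) auto
  have wv: "w S * v S * A = A" "A * (w S * v S) = A" for S A
    by (rule ell_infty_eqI, simp add: coord_times coord_v coord_w unit)+
  have idem: "q S * q S = q S" for S
  proof -
    have "q S * q S = v S * (w S * v S) * w S"
      by (simp add: q_def mult.assoc)
    then show ?thesis
      by (simp add: wv q_def)
  qed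
  have kill: "\<Phi> (q S * q T) = 0" if "S \<noteq> T" for S T
  proof (rule van, rule finite_subset)
    show "{n. coord (q S * q T) n \<noteq> 0} \<subseteq> {n. branch_code S n = branch_code T n}"
    proof (intro subsetI CollectI, rule ccontr)
      fix n assume n: "n \<in> {n. coord (q S * q T) n \<noteq> 0}"
        and neq: "branch_code S n \<noteq> branch_code T n"
      have "coord (q S * q T) n =
          V (branch_code S n) * (W (branch_code S n) * V (branch_code T n)) * W (branch_code T n)"
        by (simp add: q_def coord_times coord_v coord_w mult.assoc)
      then show False
        using n orth[OF neq] by simp
    qed
  qed (rule branch_code_agree_finite[OF that])
  have "countable {S. \<Phi> (q S) \<noteq> 0}"
  proof (rule orthogonal_idempotents_countable[OF assms(1), where P = "\<lambda>S. \<Phi> (q S)"])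
    show "\<Phi> (q S) * \<Phi> (q S) = \<Phi> (q S)" for S
      using J idem by (simp add: jordan_homomorphism_def)
    show "\<Phi> (q S) * \<Phi> (q T) = 0" if "S \<noteq> T" for S T
      using that by (intro jordan_orthogonal_images[OF J idem] kill) auto
  qed simp
  then have "{S. \<Phi> (q S) \<noteq> 0} \<noteq> UNIV"
    using uncountable_nat_sets by metis
  then obtain S where "\<Phi> (q S) = 0"
    by blast
  then have "\<Phi> x = 0" for x
    unfolding q_def by (rule jordan_zero_if_unit_equivalent_zero[OF J wv])
  then show False
    using nz by blast
qed

end
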